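(* Let $k : \Omega \times \Omega \to \mathbb{R}^{m\times m}$ be a separable matrix-valued kernel with uncoupled decomposition $(k_i,Q_i)_{i=1}^p$, and let $X = \{x_1,\dots,x_n\} \subset \Omega$. Set $\hat{k}_i := k_iQ_i$ for $i=1,\dots,p$, and assume each $\hat{k}_i$ is positive definite with RKHS $\mathcal{H}_i$; let $\mathcal{H}$ be the RKHS of $k$. Let $$\mathcal{N}_i := \operatorname{span}\{ \hat{k}_i(\cdot,x)\alpha \mid x \in X,\ \alpha \in \mathbb{R}^m \} \subset \mathcal{H}_i, \quad i = 1,\dots,p,$$ $$\mathcal{N} := \operatorname{span}\{ k(\cdot,x)\alpha \mid x \in X,\ \alpha \in \mathbb{R}^m \} \subset \mathcal{H}.$$ Then for all $x \in \Omega$ and $\alpha \in \mathbb{R}^m$, $$\sum_{i=1}^p \left( \mathcal{P}_{\mathcal{N}_i}^{\alpha}(x)\right)^2 = \mathcal{P}_{\mathcal{N}}^{\alpha}(x)^2,$$ where $\mathcal{P}_{\mathcal{N}_i}^{\alpha}$ is the power-function of $\mathcal{N}_i$ in $\mathcal{H}_i$ and $\mathcal{P}_{\mathcal{N}}^{\alpha}$ is the power-function of $\mathcal{N}$ in $\mathcal{H}$.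
   Context: $\Omega$ is a nonempty set, $m\in\mathbb{N}$. A matrix-valued kernel is a function $k : \Omega\times\Omega\to\mathbb{R}^{m\times m}$ with $k(x,y)=k(y,x)^T$ for all $x,y$; a scalar-valued kernel is the case $m=1$. $k$ is positive definite if for every finite $\{x_1,\dots,x_n\}\subset\Omega$ the block matrix $(k(x_i,x_j))_{i,j=1}^n\in\mathbb{R}^{mn\times mn}$ is positive semi-definite. The RKHS of a positive definite matrix-valued kernel $k$ is the unique real Hilbert space $\mathcal{H}$ of functions $\Omega\to\mathbb{R}^m$ such that $k(\cdot,x)\alpha\in\mathcal{H}$ and $\langle f,k(\cdot,x)\alpha\rangle_{\mathcal{H}}=f(x)^T\alpha$ for all $x\in\Omega$, $\alpha\in\mathbb{R}^m$, $f\in\mathcal{H}$. For a closed subspace $\mathcal{N}\subset\mathcal{H}$ with orthogonal projection $\Pi_{\mathcal{N}}$, the power-function is $\mathcal{P}_{\mathcal{N}}^{\alpha}(x):=\sup_{f\in\mathcal{H}\setminus\{0\}}\frac{|(f(x)-(\Pi_{\mathcal{N}}f)(x))^T\alpha|}{\|f\|_{\mathcal{H}}}$. A matrix-valued kernel $k$ is separable with decomposition $(k_i,Q_i)_{i=1}^p$ (of length $p$) if $k_1,\dots,k_p:\Omega\times\Omega\to\mathbb{R}$ are scalar-valued kernels, $Q_1,\dots,Q_p\in\mathbb{R}^{m\times m}$ are symmetric, and $k(x,y)=\sum_{i=1}^p k_i(x,y)Q_i$ for all $x,y\in\Omega$. The decomposition is uncoupled if $\operatorname{rank}\left(\sum_{i=1}^pQ_i\right)=\sum_{i=1}^p\operatorname{rank}(Q_i)$.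 *)

theory Defs
  imports "HOL-Analysis.Analysis" "HOL-Library.Function_Algebras"
begin

text \<open>
  The domain \<open>\<Omega>\<close> is the (nonempty) type \<open>'w\<close>. Functions \<open>'w \<Rightarrow> real^'m\<close> carry the
  pointwise vector space structure, so that the library notions \<^const>\<open>span\<close> and
  \<^const>\<open>subspace\<close> apply to sets of functions.
\<close>

instantiation "fun" :: (type, real_vector) real_vector
begin

definition scaleR_fun :: "real \<Rightarrow> ('a \<Rightarrow> 'b) \<Rightarrow> 'a \<Rightarrow> 'b"
  where "scaleR_fun c f = (\<lambda>x. c *\<^sub>R f x)"

instance
  by standard (auto simp: scaleR_fun_def fun_eq_iff scaleR_add_right scaleR_add_left)

end


subsection \<open>Kernels\<close>

definition scalar_kernel :: "('w \<Rightarrow> 'w \<Rightarrow> real) \<Rightarrow> bool"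
  where "scalar_kernel \<kappa> \<longleftrightarrow> (\<forall>x y. \<kappa> x y = \<kappa> y x)"

definition matrix_kernel :: "('w \<Rightarrow> 'w \<Rightarrow> real^'m^'m) \<Rightarrow> bool"
  where "matrix_kernel k \<longleftrightarrow> (\<forall>x y. k x y = transpose (k y x))"

text \<open>
  The double sum below is \<open>v\<^sup>T K v\<close> for the block matrix \<open>K = (k(x, y))\<close>, with \<open>x, y\<close>
  ranging over \<open>X\<close>, and the block vector \<open>v\<close> with blocks \<open>\<alpha> x\<close>; \<open>K\<close> is symmetric
  because \<open>k\<close> is a kernel.
\<close>

definition pos_def_kernel :: "('w \<Rightarrow> 'w \<Rightarrow> real^'m^'m) \<Rightarrow> bool"
  where "pos_def_kernel k \<longleftrightarrow> matrix_kernel k \<and>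
    (\<forall>X \<alpha>. finite X \<longrightarrow> (\<Sum>x\<in>X. \<Sum>y\<in>X. \<alpha> x \<bullet> (k x y *v \<alpha> y)) \<ge> 0)"

definition separable_decomp ::
  "('w \<Rightarrow> 'w \<Rightarrow> real^'m^'m) \<Rightarrow> nat \<Rightarrow> (nat \<Rightarrow> 'w \<Rightarrow> 'w \<Rightarrow> real) \<Rightarrow> (nat \<Rightarrow> real^'m^'m) \<Rightarrow> bool"
  where "separable_decomp k p \<kappa> Q \<longleftrightarrow> matrix_kernel k \<and>
    (\<forall>i\<in>{1..p}. scalar_kernel (\<kappa> i)) \<and>
    (\<forall>i\<in>{1..p}. transpose (Q i) = Q i) \<and>
    (\<forall>x y. k x y = (\<Sum>i=1..p. \<kappa> i x y *\<^sub>R Q i))"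

definition uncoupled :: "nat \<Rightarrow> (nat \<Rightarrow> real^'m^'m) \<Rightarrow> bool"
  where "uncoupled p Q \<longleftrightarrow> rank (\<Sum>i=1..p. Q i) = (\<Sum>i=1..p. rank (Q i))"

definition weighted_kernel :: "('w \<Rightarrow> 'w \<Rightarrow> real) \<Rightarrow> real^'m^'m \<Rightarrow> 'w \<Rightarrow> 'w \<Rightarrow> real^'m^'m"
  where "weighted_kernel \<kappa> Q = (\<lambda>x y. \<kappa> x y *\<^sub>R Q)"


subsection \<open>Hilbert spaces of functions\<close>

text \<open>
  A Hilbert space of functions is given by its carrier \<open>H\<close> and its inner product \<open>ip\<close>;
  the values of \<open>ip\<close> outside \<open>H\<close> are irrelevant.
\<close>

definition inner_on :: "'v::real_vector set \<Rightarrow> ('v \<Rightarrow> 'v \<Rightarrow> real) \<Rightarrow> bool"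
  where "inner_on H ip \<longleftrightarrow>
    (\<forall>f\<in>H. \<forall>g\<in>H. ip f g = ip g f) \<and>
    (\<forall>f\<in>H. \<forall>g\<in>H. \<forall>h\<in>H. ip (f + g) h = ip f h + ip g h) \<and>
    (\<forall>c. \<forall>f\<in>H. \<forall>g\<in>H. ip (c *\<^sub>R f) g = c * ip f g) \<and>
    (\<forall>f\<in>H. ip f f \<ge> 0) \<and>
    (\<forall>f\<in>H. ip f f = 0 \<longrightarrow> f = 0)"

definition ip_norm :: "('v \<Rightarrow> 'v \<Rightarrow> real) \<Rightarrow> 'v \<Rightarrow> real"
  where "ip_norm ip f = sqrt (ip f f)"

definition complete_on :: "'v::real_vector set \<Rightarrow> ('v \<Rightarrow> 'v \<Rightarrow> real) \<Rightarrow> bool"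
  where "complete_on H ip \<longleftrightarrow>
    (\<forall>s::nat \<Rightarrow> 'v. (\<forall>n. s n \<in> H) \<and>
        (\<forall>\<epsilon>>0. \<exists>N. \<forall>a\<ge>N. \<forall>b\<ge>N. ip_norm ip (s a - s b) < \<epsilon>) \<longrightarrow>
      (\<exists>l\<in>H. (\<lambda>n. ip_norm ip (s n - l)) \<longlonglongrightarrow> 0))"

definition hilbert_space :: "'v::real_vector set \<Rightarrow> ('v \<Rightarrow> 'v \<Rightarrow> real) \<Rightarrow> bool"
  where "hilbert_space H ip \<longleftrightarrow> subspace H \<and> inner_on H ip \<and> complete_on H ip"

definition is_RKHS :: "('w \<Rightarrow> 'w \<Rightarrow> real^'m^'m) \<Rightarrow> ('w \<Rightarrow> real^'m) set \<Rightarrow>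
    (('w \<Rightarrow> real^'m) \<Rightarrow> ('w \<Rightarrow> real^'m) \<Rightarrow> real) \<Rightarrow> bool"
  where "is_RKHS k H ip \<longleftrightarrow> hilbert_space H ip \<and>
    (\<forall>x \<alpha>. (\<lambda>y. k y x *v \<alpha>) \<in> H) \<and>
    (\<forall>x \<alpha>. \<forall>f\<in>H. ip f (\<lambda>y. k y x *v \<alpha>) = f x \<bullet> \<alpha>)"

definition kernel_span :: "('w \<Rightarrow> 'w \<Rightarrow> real^'m^'m) \<Rightarrow> 'w set \<Rightarrow> ('w \<Rightarrow> real^'m) set"
  where "kernel_span k X = span {(\<lambda>y. k y x *v \<alpha>) | x \<alpha>. x \<in> X}"

definition orth_proj :: "('v::real_vector \<Rightarrow> 'v \<Rightarrow> real) \<Rightarrow> 'v set \<Rightarrow> 'v \<Rightarrow> 'v"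
  where "orth_proj ip N f = (THE g. g \<in> N \<and> (\<forall>h\<in>N. ip (f - g) h = 0))"

text \<open>
  All quotients are nonnegative, so inserting 0 changes nothing unless \<open>H = {0}\<close>, in
  which case it fixes the value of the empty supremum to be 0.
\<close>

definition power_function :: "('w \<Rightarrow> real^'m) set \<Rightarrow>
    (('w \<Rightarrow> real^'m) \<Rightarrow> ('w \<Rightarrow> real^'m) \<Rightarrow> real) \<Rightarrow>
    ('w \<Rightarrow> real^'m) set \<Rightarrow> real^'m \<Rightarrow> 'w \<Rightarrow> real"
  where "power_function H ip N \<alpha> x =
    Sup (insert 0 ((\<lambda>f. \<bar>(f x - orth_proj ip N f x) \<bullet> \<alpha>\<bar> / ip_norm ip f) ` (H - {0})))"

end

theory Submission
  imports Defs
begin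

text \<open>
  Let \<open>u\<close> be the representer \<open>k(\<cdot>, x)\<alpha>\<close> of the functional \<open>f \<mapsto> f(x)\<^sup>T\<alpha>\<close>, and let
  \<open>r = u - \<Pi>u\<close> be its residual after projection onto \<open>\<N>\<close>. Since \<open>I - \<Pi>\<close> is self-adjoint,
  \<open>(f - \<Pi>f)(x)\<^sup>T\<alpha> = \<langle>f, r\<rangle>\<close>, so the power-function is \<open>\<parallel>r\<parallel>\<close>, and its square is
  \<open>\<langle>r, u\<rangle> = r(x)\<^sup>T\<alpha>\<close>. By the reproducing property, orthogonality of \<open>r\<close> to \<open>\<N>\<close> means that
  \<open>r\<close> vanishes on \<open>X\<close>. Thus the squared power-function is the value \<open>r(x)\<^sup>T\<alpha>\<close> for any
  \<open>r = k(\<cdot>, x)\<alpha> - \<Sum>\<^sub>y k(\<cdot>, y)\<beta>\<^sub>y\<close> that vanishes on \<open>X\<close>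
  (\<open>power_function_sq_residual\<close>), and such coefficients \<open>\<beta>\<^sub>y\<close> exist
  (\<open>residual_vanishing_exists\<close>). For fixed \<open>\<beta>\<close> this description is linear in \<open>k\<close> and
  free of inner products of functions, which makes it additive across different spaces.

  Apply this to each summand \<open>\<kappa>\<^sub>i Q\<^sub>i\<close>, which gives residuals \<open>r\<^sub>i\<close> with coefficients
  \<open>\<beta>\<^sup>i\<^sub>y\<close>. Only the vectors \<open>Q\<^sub>i \<beta>\<^sup>i\<^sub>y\<close> matter. Uncoupledness says that the column space of
  \<open>\<Sum>\<^sub>i Q\<^sub>i\<close> is the direct sum of those of the \<open>Q\<^sub>i\<close>, so there is a single vector \<open>\<beta>\<^sub>y\<close>
  with \<open>Q\<^sub>i \<beta>\<^sub>y = Q\<^sub>i \<beta>\<^sup>i\<^sub>y\<close> for all \<open>i\<close> (\<open>uncoupled_simultaneous_solution\<close>). With these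
  common coefficients the residual for \<open>k\<close> is \<open>\<Sum>\<^sub>i r\<^sub>i\<close>; it vanishes on \<open>X\<close>, and its value
  at \<open>x\<close> is the sum of the values of the \<open>r\<^sub>i\<close>.
\<close>

section \<open>Orthogonal projection onto finitely generated subspaces\<close>

locale inner_space_on =
  fixes H :: "'v::real_vector set" and ip :: "'v \<Rightarrow> 'v \<Rightarrow> real"
  assumes sub: "subspace H" and inner: "inner_on H ip"
begin

lemma commute: "f \<in> H \<Longrightarrow> g \<in> H \<Longrightarrow> ip f g = ip g f"
  using inner by (auto simp: inner_on_def)

lemma add_left: "f \<in> H \<Longrightarrow> g \<in> H \<Longrightarrow> h \<in> H \<Longrightarrow> ip (f + g) h = ip f h + ip g h"
  using inner by (auto simp: inner_on_def)

lemma scale_left: "f \<in> H \<Longrightarrow> g \<in> H \<Longrightarrow> ip (c *\<^sub>R f) g = c * ip f g"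
  using inner by (auto simp: inner_on_def)

lemma nonneg: "f \<in> H \<Longrightarrow> 0 \<le> ip f f"
  using inner by (auto simp: inner_on_def)

lemma definite: "f \<in> H \<Longrightarrow> ip f f = 0 \<Longrightarrow> f = 0"
  using inner by (auto simp: inner_on_def)

lemma add_right: "f \<in> H \<Longrightarrow> g \<in> H \<Longrightarrow> h \<in> H \<Longrightarrow> ip h (f + g) = ip h f + ip h g"
  by (metis add_left commute sub subspace_add)

lemma scale_right: "f \<in> H \<Longrightarrow> g \<in> H \<Longrightarrow> ip g (c *\<^sub>R f) = c * ip g f"
  by (metis scale_left commute sub subspace_scale)

lemma diff_left: "f \<in> H \<Longrightarrow> g \<in> H \<Longrightarrow> h \<in> H \<Longrightarrow> ip (f - g) h = ip f h - ip g h"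
  using add_left[of f "(-1) *\<^sub>R g" h] scale_left[of g h "-1"] subspace_scale[OF sub, of g "-1"]
  by simp

lemma diff_right: "f \<in> H \<Longrightarrow> g \<in> H \<Longrightarrow> h \<in> H \<Longrightarrow> ip h (f - g) = ip h f - ip h g"
  by (metis diff_left commute sub subspace_diff)

lemma zero_right: "f \<in> H \<Longrightarrow> ip f 0 = 0"
  using scale_right[of f f 0] by simp

lemma Cauchy_Schwarz:
  assumes f: "f \<in> H" and g: "g \<in> H"
  shows "\<bar>ip f g\<bar> \<le> ip_norm ip f * ip_norm ip g"
proof -
  have "(ip f g)\<^sup>2 \<le> ip f f * ip g g"
  proof (cases "ip g g = 0")
    case True
    then have "g = 0" using definite g by blast
    then show ?thesis using zero_right[OF f] zero_right[OF g] by simp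
  next
    case False
    then have pos: "ip g g > 0" using nonneg[OF g] by simp
    define c where "c = ip f g / ip g g"
    have cg: "c *\<^sub>R g \<in> H" and d: "f - c *\<^sub>R g \<in> H"
      using f g sub by (auto intro: subspace_scale subspace_diff)
    have "0 \<le> ip (f - c *\<^sub>R g) (f - c *\<^sub>R g)" using nonneg d by blast
    also have "\<dots> = ip f f - 2 * c * ip f g + c * c * ip g g"
      using f g cg d commute[OF f g]
      by (simp add: diff_left diff_right scale_left scale_right algebra_simps)
    also have "\<dots> = ip f f - (ip f g)\<^sup>2 / ip g g"
      using pos by (simp add: c_def power2_eq_square field_simps)
    finally show ?thesis using pos by (simp add: field_simps)
  qed
  then have "sqrt ((ip f g)\<^sup>2) \<le> sqrt (ip f f * ip g g)" by (rule real_sqrt_le_mono)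
  then show ?thesis by (simp add: ip_norm_def real_sqrt_mult)
qed

lemma orthogonal_span:
  assumes B: "B \<subseteq> H" and f: "f \<in> H" and orth: "\<And>b. b \<in> B \<Longrightarrow> ip f b = 0" and h: "h \<in> span B"
  shows "ip f h = 0"
proof -
  have "span B \<subseteq> {h \<in> H. ip f h = 0}"
    using B orth f sub
    by (intro span_minimal)
       (auto simp: subspace_def add_right scale_right zero_right)
  then show ?thesis using h by auto
qed

text \<open>
  Gram--Schmidt: when a generator \<open>b\<close> is added, project along its component \<open>e\<close> orthogonal
  to the old span; this also covers \<open>e = 0\<close>, because division by zero then yields the
  coefficient 0.
\<close>

lemma projection_exists:
  assumes "finite B" "B \<subseteq> H" "f \<in> H"
  shows "\<exists>g \<in> span B. \<forall>h \<in> span B. ip (f - g) h = 0"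
  using assms
proof (induction B arbitrary: f rule: finite_induct)
  case empty
  then show ?case by (auto simp: zero_right)
next
  case (insert b B)
  have B: "B \<subseteq> H" and b: "b \<in> H" and f: "f \<in> H" using insert.prems by auto
  have SB: "span B \<subseteq> H" using B sub by (simp add: span_minimal)
  obtain g where g: "g \<in> span B" "\<And>h. h \<in> span B \<Longrightarrow> ip (f - g) h = 0"
    using insert.IH[OF B f] by blast
  obtain c where c: "c \<in> span B" "\<And>h. h \<in> span B \<Longrightarrow> ip (b - c) h = 0"
    using insert.IH[OF B b] by blast
  define e where "e = b - c"
  define t where "t = ip (f - g) e / ip e e"
  have H: "g \<in> H" "c \<in> H" "e \<in> H" "f - g \<in> H" "t *\<^sub>R e \<in> H" "f - g - t *\<^sub>R e \<in> H"
    using SB g c b f sub unfolding e_def by (auto intro!: subspace_diff subspace_scale)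
  have res: "f - (g + t *\<^sub>R e) = f - g - t *\<^sub>R e" by simp
  have oB: "ip (f - g - t *\<^sub>R e) h = 0" if "h \<in> span B" for h
  proof -
    have "h \<in> H" using that SB by auto
    then show ?thesis using that g(2) c(2) H by (simp add: diff_left scale_left e_def)
  qed
  have oe: "ip (f - g - t *\<^sub>R e) e = 0"
  proof (cases "e = 0")
    case True
    then show ?thesis using zero_right f H by simp
  next
    case False
    then have "ip e e \<noteq> 0" using definite H by blast
    then show ?thesis using H(3-5) by (simp add: diff_left scale_left t_def)
  qed
  have "ip (f - g - t *\<^sub>R e) b = ip (f - g - t *\<^sub>R e) (e + c)" by (simp add: e_def)
  also have "\<dots> = 0" using oe oB[OF c(1)] H(2,3,6) by (simp add: add_right)
  finally have ob: "ip (f - g - t *\<^sub>R e) b = 0" .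
  have "ip (f - (g + t *\<^sub>R e)) h = 0" if "h \<in> span (insert b B)" for h
    unfolding res using orthogonal_span[OF insert.prems(1) H(6) _ that] ob oB span_base by auto
  moreover have "g + t *\<^sub>R e \<in> span (insert b B)"
  proof -
    have "span B \<subseteq> span (insert b B)" by (simp add: span_mono subset_insertI)
    then show ?thesis using g(1) c(1) span_base[of b "insert b B"] unfolding e_def
      by (auto intro!: span_add span_scale span_diff)
  qed
  ultimately show ?case by blast
qed

lemma orth_proj_eqI:
  assumes N: "subspace N" "N \<subseteq> H" and f: "f \<in> H"
    and g: "g \<in> N" "\<And>h. h \<in> N \<Longrightarrow> ip (f - g) h = 0"
  shows "orth_proj ip N f = g"
  unfolding orth_proj_def
proof (rule the_equality)
  show "g \<in> N \<and> (\<forall>h\<in>N. ip (f - g) h = 0)" using g by blast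
next
  fix g' assume g': "g' \<in> N \<and> (\<forall>h\<in>N. ip (f - g') h = 0)"
  have d: "g' - g \<in> N" using N g g' by (simp add: subspace_diff)
  have H: "f - g \<in> H" "f - g' \<in> H" "g' - g \<in> H"
    using N f g g' d sub by (auto intro: subspace_diff)
  have "ip (g' - g) (g' - g) = ip ((f - g) - (f - g')) (g' - g)" by simp
  also have "\<dots> = 0" using diff_left[OF H] g(2)[OF d] g' d by simp
  finally show "g' = g" using definite[OF H(3)] by simp
qed

end


section \<open>Power-functions as values of residuals\<close>

lemma is_RKHS_inner_space_on: "is_RKHS k H ip \<Longrightarrow> inner_space_on H ip"
  by (simp add: is_RKHS_def hilbert_space_def inner_space_on_def)

lemma kernel_span_subset_RKHS: "is_RKHS k H ip \<Longrightarrow> kernel_span k X \<subseteq> H"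
  unfolding kernel_span_def is_RKHS_def hilbert_space_def by (intro span_minimal) auto

lemma kernel_span_eq_sums:
  assumes "finite X"
  shows "kernel_span k X = range (\<lambda>\<beta> z. \<Sum>y\<in>X. k z y *v \<beta> y)"
proof
  show "kernel_span k X \<subseteq> range (\<lambda>\<beta> z. \<Sum>y\<in>X. k z y *v \<beta> y)" (is "_ \<subseteq> ?S")
    unfolding kernel_span_def
  proof (intro span_minimal subsetI)
    fix f assume "f \<in> {(\<lambda>y. k y x *v \<alpha>) | x \<alpha>. x \<in> X}"
    then obtain x \<alpha> where f: "f = (\<lambda>y. k y x *v \<alpha>)" "x \<in> X" by blast
    have "f = (\<lambda>z. \<Sum>y\<in>X. k z y *v (if y = x then \<alpha> else 0))"
      using f assms by (auto simp: if_distrib[of "\<lambda>v. _ *v v"] cong: if_cong)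
    then show "f \<in> ?S" by (intro range_eqI[of _ _ "\<lambda>y. if y = x then \<alpha> else 0"])
  next
    show "subspace ?S"
    proof (rule subspaceI)
      show "0 \<in> ?S" by (rule range_eqI[of _ _ "\<lambda>_. 0"]) (simp add: fun_eq_iff)
    next
      fix f g assume "f \<in> ?S" "g \<in> ?S"
      then obtain \<beta> \<gamma> where "f = (\<lambda>z. \<Sum>y\<in>X. k z y *v \<beta> y)" "g = (\<lambda>z. \<Sum>y\<in>X. k z y *v \<gamma> y)"
        by blast
      then show "f + g \<in> ?S"
        by (intro range_eqI[of _ _ "\<lambda>y. \<beta> y + \<gamma> y"])
           (simp add: fun_eq_iff matrix_vector_right_distrib sum.distrib)
    next
      fix c f assume "f \<in> ?S"
      then obtain \<beta> where "f = (\<lambda>z. \<Sum>y\<in>X. k z y *v \<beta> y)" by blast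
      then show "c *\<^sub>R f \<in> ?S"
        by (intro range_eqI[of _ _ "\<lambda>y. c *\<^sub>R \<beta> y"])
           (simp add: fun_eq_iff scaleR_fun_def matrix_vector_mult_scaleR scaleR_right.sum)
    qed
  qed
next
  have "(\<lambda>z. \<Sum>y\<in>X. k z y *v \<beta> y) = (\<Sum>y\<in>X. (\<lambda>z. k z y *v \<beta> y))" for \<beta>
    by (induction X rule: infinite_finite_induct) (auto simp: fun_eq_iff)
  then show "range (\<lambda>\<beta> z. \<Sum>y\<in>X. k z y *v \<beta> y) \<subseteq> kernel_span k X"
    unfolding kernel_span_def
    by (simp only: image_subset_iff) (intro ballI span_sum span_base, blast)
qed

text \<open>
  There may be infinitely many defining generators; linearity in \<open>\<alpha>\<close> reduces them to standard basis
  vectors, so that Gram--Schmidt applies.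
\<close>

lemma kernel_span_finitely_generated:
  assumes "finite X"
  obtains B where "finite B" "kernel_span k X = span B"
proof
  define \<phi> where "\<phi> = (\<lambda>y (\<beta>::real^'b) z. k z y *v \<beta>)"
  let ?B = "\<Union>y\<in>X. \<phi> y ` Basis"
  show "finite ?B" using assms by simp
  have lin: "linear (\<phi> y)" for y
    by (rule linearI)
       (auto simp: \<phi>_def fun_eq_iff scaleR_fun_def matrix_vector_right_distrib
          matrix_vector_mult_scaleR)
  have "\<phi> y \<beta> \<in> span ?B" if "y \<in> X" for y \<beta>
  proof -
    have "\<phi> y \<beta> \<in> \<phi> y ` span Basis" by simp
    also have "\<dots> = span (\<phi> y ` Basis)" using linear_span_image[OF lin] by metis
    also have "\<dots> \<subseteq> span ?B" using that by (intro span_mono) auto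
    finally show ?thesis .
  qed
  then have "kernel_span k X \<subseteq> span ?B"
    unfolding kernel_span_def by (intro span_minimal) (auto simp: \<phi>_def)
  moreover have "span ?B \<subseteq> kernel_span k X"
    unfolding kernel_span_def by (rule span_mono) (auto simp: \<phi>_def)
  ultimately show "kernel_span k X = span ?B" by blast
qed

lemma kernel_span_projection_exists:
  assumes "is_RKHS k H ip" "finite X" "f \<in> H"
  shows "\<exists>g \<in> kernel_span k X. \<forall>h \<in> kernel_span k X. ip (f - g) h = 0"
proof -
  interpret inner_space_on H ip using assms(1) by (rule is_RKHS_inner_space_on)
  obtain B where B: "finite B" "kernel_span k X = span B"
    using kernel_span_finitely_generated[OF assms(2), of k] .
  then have "B \<subseteq> H" using kernel_span_subset_RKHS[OF assms(1), of X] span_superset[of B] by auto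
  then show ?thesis using projection_exists[OF B(1) _ assms(3)] B(2) by simp
qed

lemma orthogonal_kernel_span_iff_vanishes:
  assumes "is_RKHS k H ip" "r \<in> H"
  shows "(\<forall>h \<in> kernel_span k X. ip r h = 0) \<longleftrightarrow> (\<forall>y\<in>X. r y = 0)"
proof
  have rep: "ip r (\<lambda>z. k z y *v \<gamma>) = r y \<bullet> \<gamma>" for y \<gamma>
    using assms by (simp add: is_RKHS_def)
  {
    assume *: "\<forall>h \<in> kernel_span k X. ip r h = 0"
    have "r y \<bullet> r y = 0" if "y \<in> X" for y
    proof -
      have "(\<lambda>z. k z y *v r y) \<in> kernel_span k X"
        unfolding kernel_span_def using that by (intro span_base) blast
      then show ?thesis using * rep by metis
    qed
    then show "\<forall>y\<in>X. r y = 0" by simp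
  next
    interpret inner_space_on H ip using assms(1) by (rule is_RKHS_inner_space_on)
    have gens: "{(\<lambda>y. k y x *v \<alpha>) | x \<alpha>. x \<in> X} \<subseteq> H"
      using assms(1) by (auto simp: is_RKHS_def)
    assume "\<forall>y\<in>X. r y = 0"
    then have "ip r b = 0" if "b \<in> {(\<lambda>y. k y x *v \<alpha>) | x \<alpha>. x \<in> X}" for b
      using that rep by auto
    then show "\<forall>h \<in> kernel_span k X. ip r h = 0"
      unfolding kernel_span_def using orthogonal_span[OF gens assms(2)] by blast
  }
qed

text \<open>The coefficients are those of the projection of \<open>k(\<cdot>, x)\<alpha>\<close> onto the kernel span.\<close>

lemma residual_vanishing_exists:
  assumes "is_RKHS k H ip" "finite X"
  shows "\<exists>\<beta>. \<forall>z\<in>X. k z x *v \<alpha> - (\<Sum>y\<in>X. k z y *v \<beta> y) = 0"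
proof -
  define u where "u = (\<lambda>z. k z x *v \<alpha>)"
  have u: "u \<in> H" using assms(1) by (simp add: is_RKHS_def u_def)
  obtain g where g: "g \<in> kernel_span k X" "\<forall>h \<in> kernel_span k X. ip (u - g) h = 0"
    using kernel_span_projection_exists[OF assms u] by blast
  obtain \<beta> where \<beta>: "g = (\<lambda>z. \<Sum>y\<in>X. k z y *v \<beta> y)"
    using g(1) kernel_span_eq_sums[OF assms(2), of k] by auto
  have "u - g \<in> H"
    using u g(1) kernel_span_subset_RKHS[OF assms(1)] assms(1)
    by (auto simp: is_RKHS_def hilbert_space_def intro: subspace_diff)
  then have "\<forall>z\<in>X. (u - g) z = 0"
    using orthogonal_kernel_span_iff_vanishes[OF assms(1), of "u - g" X] g(2) by blast
  then show ?thesis by (auto simp: u_def \<beta>)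
qed

text \<open>
  The quotients in the power-function are \<open>\<bar>\<langle>f, r\<rangle>\<bar> / \<parallel>f\<parallel>\<close>, because \<open>f - \<Pi>f\<close> is orthogonal to
  the projection of \<open>k(\<cdot>, x)\<alpha>\<close>, and \<open>r\<close> to \<open>\<Pi>f\<close>. The supremum is the norm of the functional \<open>f \<mapsto> \<langle>f, r\<rangle>\<close>, which is attained at \<open>f = r\<close>
  unless \<open>r = 0\<close>.
\<close>

lemma power_function_sq_residual:
  fixes k :: "'w \<Rightarrow> 'w \<Rightarrow> real^'m^'m"
  assumes rkhs: "is_RKHS k H ip" and X: "finite X"
    and r: "r = (\<lambda>z. k z x *v \<alpha> - (\<Sum>y\<in>X. k z y *v \<beta> y))"
    and van: "\<And>y. y \<in> X \<Longrightarrow> r y = 0"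
  shows "(power_function H ip (kernel_span k X) \<alpha> x)\<^sup>2 = r x \<bullet> \<alpha>"
proof -
  interpret inner_space_on H ip using rkhs by (rule is_RKHS_inner_space_on)
  define N where "N = kernel_span k X"
  define u where "u = (\<lambda>z. k z x *v \<alpha>)"
  define g where "g = (\<lambda>z. \<Sum>y\<in>X. k z y *v \<beta> y)"
  have NH: "N \<subseteq> H" unfolding N_def using rkhs by (rule kernel_span_subset_RKHS)
  have subN: "subspace N" unfolding N_def kernel_span_def by (rule subspace_span)
  have gN: "g \<in> N" unfolding N_def g_def kernel_span_eq_sums[OF X] by (rule rangeI)
  have rug: "r = u - g" by (simp add: r u_def g_def fun_eq_iff)
  have u: "u \<in> H" and rep: "\<And>f. f \<in> H \<Longrightarrow> ip f u = f x \<bullet> \<alpha>"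
    using rkhs by (auto simp: is_RKHS_def u_def)
  have gH: "g \<in> H" using gN NH by blast
  have rH: "r \<in> H" unfolding rug using u gH sub by (simp add: subspace_diff)
  have orth: "ip r h = 0" if "h \<in> N" for h
    using orthogonal_kernel_span_iff_vanishes[OF rkhs rH, of X] van that by (auto simp: N_def)
  have ev: "(f x - orth_proj ip N f x) \<bullet> \<alpha> = ip f r" if f: "f \<in> H" for f
  proof -
    obtain q where q: "q \<in> N" "\<And>h. h \<in> N \<Longrightarrow> ip (f - q) h = 0"
      using kernel_span_projection_exists[OF rkhs X f] unfolding N_def by blast
    have proj: "orth_proj ip N f = q" by (rule orth_proj_eqI[OF subN NH f q])
    have qH: "q \<in> H" and fq: "f - q \<in> H" using q(1) NH f sub by (auto intro: subspace_diff)
    have "(f x - q x) \<bullet> \<alpha> = ip (f - q) u" using rep[OF fq] by simp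
    also have "u = r + g" by (simp add: rug)
    also have "ip (f - q) (r + g) = ip f r - ip q r"
      using q(2)[OF gN] rH gH fq f qH by (simp add: add_right diff_left)
    also have "ip q r = 0" using orth[OF q(1)] commute[OF qH rH] by simp
    finally show ?thesis by (simp add: proj)
  qed
  define S where "S = (\<lambda>f. \<bar>(f x - orth_proj ip N f x) \<bullet> \<alpha>\<bar> / ip_norm ip f) ` (H - {0})"
  have n0: "0 \<le> ip_norm ip f" if "f \<in> H" for f using nonneg[OF that] by (simp add: ip_norm_def)
  have le: "s \<le> ip_norm ip r" if s: "s \<in> insert 0 S" for s
  proof (cases "s = 0")
    case True
    then show ?thesis using n0 rH by simp
  next
    case False
    then obtain f where f: "f \<in> H" "f \<noteq> 0" and s_eq: "s = \<bar>ip f r\<bar> / ip_norm ip f"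
      using s ev by (auto simp: S_def)
    have "0 < ip_norm ip f"
      using definite[OF f(1)] nonneg[OF f(1)] f(2) by (auto simp: ip_norm_def less_le)
    then show ?thesis using Cauchy_Schwarz[OF f(1) rH] by (simp add: s_eq field_simps)
  qed
  have "ip_norm ip r \<in> insert 0 S"
  proof (cases "r = 0")
    case True
    then show ?thesis using zero_right[OF rH] by (simp add: ip_norm_def)
  next
    case False
    then have "\<bar>ip r r\<bar> / ip_norm ip r \<in> S"
      unfolding S_def using rH ev[OF rH] by (intro image_eqI[of _ _ r]) auto
    moreover have "\<bar>ip r r\<bar> / ip_norm ip r = ip_norm ip r"
      using nonneg[OF rH] by (simp add: ip_norm_def real_div_sqrt)
    ultimately show ?thesis by simp
  qed
  then have "Sup (insert 0 S) = ip_norm ip r"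
    using le by (intro cSup_eq_maximum)
  then have "(power_function H ip N \<alpha> x)\<^sup>2 = ip r r"
    using nonneg[OF rH] by (simp add: power_function_def S_def ip_norm_def)
  also have "\<dots> = ip r u"
    using orth[OF gN] diff_right[OF u gH rH] unfolding rug by simp
  also have "\<dots> = r x \<bullet> \<alpha>" using rep[OF rH] .
  finally show ?thesis by (simp add: N_def)
qed


section \<open>Uncoupled families of matrices\<close>

definition sum_of_sets :: "'i set \<Rightarrow> ('i \<Rightarrow> 'v::comm_monoid_add set) \<Rightarrow> 'v set"
  where "sum_of_sets J V = {sum v J | v. \<forall>i\<in>J. v i \<in> V i}"

lemma sum_of_sets_insert:
  assumes "finite J" "i \<notin> J"
  shows "sum_of_sets (insert i J) V = {a + b | a b. a \<in> V i \<and> b \<in> sum_of_sets J V}" (is "?L = ?R")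
proof
  show "?L \<subseteq> ?R" using assms by (fastforce simp: sum_of_sets_def)
  show "?R \<subseteq> ?L"
  proof
    fix z assume "z \<in> ?R"
    then obtain a v where z: "z = a + sum v J" "a \<in> V i" "\<forall>j\<in>J. v j \<in> V j"
      by (auto simp: sum_of_sets_def)
    have "sum (v(i := a)) J = sum v J" using assms by (intro sum.cong) auto
    then have "z = sum (v(i := a)) (insert i J)" using assms z by simp
    moreover have "\<forall>j\<in>insert i J. (v(i := a)) j \<in> V j" using z by auto
    ultimately show "z \<in> ?L" unfolding sum_of_sets_def by blast
  qed
qed

lemma subspace_sum_of_sets:
  assumes "finite J" "\<And>i. i \<in> J \<Longrightarrow> subspace (V i)"
  shows "subspace (sum_of_sets J V)"
  using assms
proof (induction J rule: finite_induct)
  case empty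
  then show ?case by (simp add: sum_of_sets_def)
next
  case (insert i J)
  then show ?case
    using insert subspace_sums[of "V i" "sum_of_sets J V"] by (simp add: sum_of_sets_insert)
qed

lemma dim_sum_of_sets_insert:
  fixes V :: "'i \<Rightarrow> 'v::euclidean_space set"
  assumes "finite J" "i \<notin> J" "\<And>j. j \<in> insert i J \<Longrightarrow> subspace (V j)"
  shows "dim (sum_of_sets (insert i J) V) + dim (V i \<inter> sum_of_sets J V)
    = dim (V i) + dim (sum_of_sets J V)"
  using dim_sums_Int[of "V i" "sum_of_sets J V"] subspace_sum_of_sets[of J V] assms
  by (simp add: sum_of_sets_insert)

lemma dim_sum_of_sets_le:
  fixes V :: "'i \<Rightarrow> 'v::euclidean_space set"
  assumes "finite J" "\<And>i. i \<in> J \<Longrightarrow> subspace (V i)"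
  shows "dim (sum_of_sets J V) \<le> (\<Sum>i\<in>J. dim (V i))"
  using assms
proof (induction J rule: finite_induct)
  case empty
  then show ?case by (simp add: sum_of_sets_def)
next
  case (insert i J)
  then show ?case using dim_sum_of_sets_insert[of J i V] by fastforce
qed

text \<open>
  Adding one subspace at a time, a nonzero intersection with the sum of the earlier ones would
  lose dimension for good; so full dimension makes the sum direct.
\<close>

lemma direct_sum_if_dim_eq:
  fixes V :: "'i \<Rightarrow> 'v::euclidean_space set"
  assumes "finite J" "\<And>i. i \<in> J \<Longrightarrow> subspace (V i)"
    and "dim (sum_of_sets J V) = (\<Sum>i\<in>J. dim (V i))"
    and "\<And>i. i \<in> J \<Longrightarrow> v i \<in> V i" and "sum v J = 0" and "i \<in> J"
  shows "v i = 0"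
  using assms
proof (induction J arbitrary: i rule: finite_induct)
  case empty
  then show ?case by simp
next
  case (insert j J)
  have le: "dim (sum_of_sets J V) \<le> (\<Sum>i\<in>J. dim (V i))"
    using dim_sum_of_sets_le[of J V] insert.hyps insert.prems(1) by simp
  have eq: "dim (sum_of_sets (insert j J) V) + dim (V j \<inter> sum_of_sets J V)
    = dim (V j) + dim (sum_of_sets J V)"
    using dim_sum_of_sets_insert[of J j V] insert.hyps insert.prems(1) by blast
  have total: "dim (sum_of_sets (insert j J) V) = dim (V j) + (\<Sum>i\<in>J. dim (V i))"
    using insert.prems(2) insert.hyps by simp
  have dims: "dim (sum_of_sets J V) = (\<Sum>i\<in>J. dim (V i))" "dim (V j \<inter> sum_of_sets J V) = 0"
    using le eq total by linarith+
  have sJ: "sum v J = - v j"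
    using insert.prems(4) insert.hyps by (simp add: eq_neg_iff_add_eq_0 add.commute)
  have "sum v J \<in> sum_of_sets J V" using insert.prems(3) by (auto simp: sum_of_sets_def)
  moreover have "sum v J \<in> V j"
    using sJ insert.prems(1,3) by (simp add: subspace_neg)
  ultimately have "sum v J = 0" using dims(2) dim_eq_0[of "V j \<inter> sum_of_sets J V"] by blast
  then show ?case using insert.IH[of i] dims(1) insert.prems sJ by auto
qed

text \<open>
  The column space of \<open>\<Sum>\<^sub>i Q\<^sub>i\<close> lies in the sum of those of the \<open>Q\<^sub>i\<close>. If the ranks add up,
  the two coincide and the sum is direct, so solving \<open>(\<Sum>\<^sub>i Q\<^sub>i) b = \<Sum>\<^sub>i Q\<^sub>i (\<beta> i)\<close> for \<open>b\<close>
  already solves all equations separately.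
\<close>

lemma uncoupled_simultaneous_solution:
  fixes Q :: "nat \<Rightarrow> real^'m^'m"
  assumes "uncoupled p Q"
  shows "\<exists>b. \<forall>i\<in>{1..p}. Q i *v b = Q i *v \<beta> i"
proof -
  define V where "V = (\<lambda>i. range ((*v) (Q i)))"
  define W where "W = sum_of_sets {1..p} V"
  define S where "S = (\<Sum>i=1..p. Q i)"
  have subV: "subspace (V i)" for i
    unfolding V_def by (intro linear_subspace_image matrix_vector_mul_linear subspace_UNIV)
  have subW: "subspace W" unfolding W_def using subV by (intro subspace_sum_of_sets) auto
  have Sv: "S *v b = (\<Sum>i=1..p. Q i *v b)" for b
    unfolding S_def by (induction p) (auto simp: matrix_vector_mult_add_rdistrib)
  have incl: "range ((*v) S) \<subseteq> W"
    unfolding W_def sum_of_sets_def Sv V_def by blast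
  have dimS: "dim (range ((*v) S)) = (\<Sum>i=1..p. dim (V i))"
    using assms unfolding uncoupled_def S_def V_def by (simp add: rank_dim_range)
  have leW: "dim W \<le> (\<Sum>i=1..p. dim (V i))"
    unfolding W_def using subV by (intro dim_sum_of_sets_le) auto
  have "range ((*v) S) = W"
    using incl dimS leW subW
    by (intro subspace_dim_equal linear_subspace_image matrix_vector_mul_linear subspace_UNIV) auto
  then have dimW: "dim W = (\<Sum>i=1..p. dim (V i))" using dimS by simp
  have "(\<Sum>i=1..p. Q i *v \<beta> i) \<in> W"
    unfolding W_def sum_of_sets_def V_def by blast
  then obtain b where b: "(\<Sum>i=1..p. Q i *v \<beta> i) = S *v b"
    using \<open>range ((*v) S) = W\<close> by blast
  have "Q i *v b - Q i *v \<beta> i = 0" if "i \<in> {1..p}" for i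
  proof (rule direct_sum_if_dim_eq[of "{1..p}" V])
    show "Q i *v b - Q i *v \<beta> i \<in> V i" for i
      unfolding V_def by (metis matrix_vector_mult_diff_distrib rangeI)
    show "(\<Sum>i=1..p. Q i *v b - Q i *v \<beta> i) = 0" using b by (simp add: sum_subtractf Sv)
  qed (use subV dimW that in \<open>auto simp: W_def\<close>)
  then show ?thesis by (metis eq_iff_diff_eq_0)
qed


section \<open>Additivity of the squared power-function\<close>

theorem lemma3p15:
  fixes k :: "'w \<Rightarrow> 'w \<Rightarrow> real^'m^'m"
    and p :: nat
    and \<kappa> :: "nat \<Rightarrow> 'w \<Rightarrow> 'w \<Rightarrow> real"
    and Q :: "nat \<Rightarrow> real^'m^'m"
    and X :: "'w set"
    and H :: "('w \<Rightarrow> real^'m) set"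
    and ip :: "('w \<Rightarrow> real^'m) \<Rightarrow> ('w \<Rightarrow> real^'m) \<Rightarrow> real"
    and Hi :: "nat \<Rightarrow> ('w \<Rightarrow> real^'m) set"
    and ipi :: "nat \<Rightarrow> ('w \<Rightarrow> real^'m) \<Rightarrow> ('w \<Rightarrow> real^'m) \<Rightarrow> real"
    and x :: 'w
    and \<alpha> :: "real^'m"
  assumes "separable_decomp k p \<kappa> Q"
    and "uncoupled p Q"
    and "finite X"
    and "\<And>i. i \<in> {1..p} \<Longrightarrow> pos_def_kernel (weighted_kernel (\<kappa> i) (Q i))"
    and "\<And>i. i \<in> {1..p} \<Longrightarrow> is_RKHS (weighted_kernel (\<kappa> i) (Q i)) (Hi i) (ipi i)"
    and "is_RKHS k H ip"
  shows "(\<Sum>i=1..p. (power_function (Hi i) (ipi i)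
            (kernel_span (weighted_kernel (\<kappa> i) (Q i)) X) \<alpha> x)\<^sup>2)
         = (power_function H ip (kernel_span k X) \<alpha> x)\<^sup>2"
proof -
  let ?K = "\<lambda>i. weighted_kernel (\<kappa> i) (Q i)"
  have "\<exists>\<beta>. \<forall>z\<in>X. ?K i z x *v \<alpha> - (\<Sum>y\<in>X. ?K i z y *v \<beta> y) = 0" if "i \<in> {1..p}" for i
    using residual_vanishing_exists[OF assms(5)[OF that] assms(3)] .
  then obtain \<beta> where \<beta>:
    "\<And>i z. i \<in> {1..p} \<Longrightarrow> z \<in> X \<Longrightarrow> ?K i z x *v \<alpha> - (\<Sum>y\<in>X. ?K i z y *v \<beta> i y) = 0"
    by metis
  have "\<exists>b. \<forall>i\<in>{1..p}. Q i *v b = Q i *v \<beta> i y" for y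
    using uncoupled_simultaneous_solution[OF assms(2), of "\<lambda>i. \<beta> i y"] .
  then obtain b where b: "\<And>i y. i \<in> {1..p} \<Longrightarrow> Q i *v b y = Q i *v \<beta> i y"
    by metis
  define r where "r = (\<lambda>i z. ?K i z x *v \<alpha> - (\<Sum>y\<in>X. ?K i z y *v b y))"
  have "(\<Sum>y\<in>X. ?K i z y *v \<beta> i y) = (\<Sum>y\<in>X. ?K i z y *v b y)" if "i \<in> {1..p}" for i z
    using b[OF that] by (simp add: weighted_kernel_def scaleR_matrix_vector_assoc[symmetric])
  then have van: "r i z = 0" if "i \<in> {1..p}" "z \<in> X" for i z
    using \<beta>[OF that] that(1) by (simp add: r_def)
  have summand: "(power_function (Hi i) (ipi i) (kernel_span (?K i) X) \<alpha> x)\<^sup>2 = r i x \<bullet> \<alpha>"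
    if "i \<in> {1..p}" for i
    using power_function_sq_residual[OF assms(5)[OF that] assms(3) r_def[THEN fun_cong]] van[OF that]
    by blast
  have k_sum: "k z y *v v = (\<Sum>i=1..p. ?K i z y *v v)" for z y v
  proof -
    have "(\<Sum>i\<in>I. A i) *v v = (\<Sum>i\<in>I. A i *v v)" for A :: "nat \<Rightarrow> real^'m^'m" and I
      by (induction I rule: infinite_finite_induct) (auto simp: matrix_vector_mult_add_rdistrib)
    then show ?thesis
      using assms(1) by (simp add: separable_decomp_def weighted_kernel_def)
  qed
  have res: "(\<lambda>z. \<Sum>i=1..p. r i z) = (\<lambda>z. k z x *v \<alpha> - (\<Sum>y\<in>X. k z y *v b y))"
  proof
    fix z
    have "(\<Sum>y\<in>X. k z y *v b y) = (\<Sum>i=1..p. \<Sum>y\<in>X. ?K i z y *v b y)"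
      unfolding k_sum by (rule sum.swap)
    then show "(\<Sum>i=1..p. r i z) = k z x *v \<alpha> - (\<Sum>y\<in>X. k z y *v b y)"
      by (simp add: r_def sum_subtractf k_sum)
  qed
  have "(power_function H ip (kernel_span k X) \<alpha> x)\<^sup>2 = (\<Sum>i=1..p. r i x) \<bullet> \<alpha>"
    using van by (intro power_function_sq_residual[OF assms(6) assms(3) res]) simp
  also have "\<dots> = (\<Sum>i=1..p. r i x \<bullet> \<alpha>)" by (rule inner_sum_left)
  finally show ?thesis using summand by simp
qed

end
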